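(* If $V$ is a real-valued function analytic at $0$ with $V(0)=1$ and $V''(0)<0$, then $V$ cannot be the variance function of a free exponential family generated by a centered $\boxplus$-infinitely divisible probability measure.
   Context: A compactly supported probability measure $\nu$ with mean $m_0$ generates the free exponential family with variance function $V$ if there is an open interval $(A,B)\ni m_0$ such that $V>0$ on $(A,B)$ and, for every $m\in(A,B)$, $Q_m(dx)=\frac{V(m)}{V(m)+(m-m_0)(m-x)}\,\nu(dx)$ is a probability measure with mean $m$ and variance $V(m)$. Centered means mean zero, so here $m_0=0$. $R$-transform: with $G_\nu(z)=\int\frac{1}{z-x}\nu(dx)$ and $K_\nu=G_\nu^{-1}$ (defined for small $z\neq0$), $R_\nu(z)=K_\nu(z)-1/z$. The free additive convolution $\mu\boxplus\nu$ of compactly supported probability measures is the unique compactly supported probability measure with $R_{\mu\boxplus\nu}=R_\mu+R_\nu$ near $0$. A measure $\mu$ is $\boxplus$-infinitely divisible if for every $n=1,2,\dots$ there is a probability measure $\nu_n$ such that $\mu=\nu_n\boxplus\cdots\boxplus\nu_n$ ($n$-fold). *)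

theory Defs
  imports "HOL-Probability.Probability"
begin

definition compactly_supported :: "real measure \<Rightarrow> bool" where
  "compactly_supported \<nu> \<longleftrightarrow> (\<exists>K. compact K \<and> (AE x in \<nu>. x \<in> K))"

definition cs_distribution :: "real measure \<Rightarrow> bool" where
  "cs_distribution \<nu> \<longleftrightarrow> real_distribution \<nu> \<and> compactly_supported \<nu>"

definition mean :: "real measure \<Rightarrow> real" where
  "mean \<nu> = (\<integral>x. x \<partial>\<nu>)"

definition var :: "real measure \<Rightarrow> real" where
  "var \<nu> = (\<integral>x. (x - mean \<nu>)\<^sup>2 \<partial>\<nu>)"


definition fef_member :: "real measure \<Rightarrow> (real \<Rightarrow> real) \<Rightarrow> real \<Rightarrow> real measure" where
  "fef_member \<nu> V m =
     density \<nu> (\<lambda>x. ennreal (V m / (V m + (m - mean \<nu>) * (m - x))))"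

(* The almost-everywhere positivity of the denominator is part of "fef_member is a probability
   measure": ennreal truncates a negative density to 0, and division by 0 yields 0, so
   prob_space alone would not exclude a density that is negative or undefined on a set of
   positive measure. *)
definition generates_fef :: "real measure \<Rightarrow> (real \<Rightarrow> real) \<Rightarrow> bool" where
  "generates_fef \<nu> V \<longleftrightarrow>
     cs_distribution \<nu> \<and>
     (\<exists>A B :: ereal. mean \<nu> \<in> einterval A B \<and>
        (\<forall>m \<in> einterval A B. 0 < V m \<and>
           (AE x in \<nu>. 0 < V m + (m - mean \<nu>) * (m - x)) \<and>
           prob_space (fef_member \<nu> V m) \<and>
           mean (fef_member \<nu> V m) = m \<and>
           var (fef_member \<nu> V m) = V m))"


definition cauchy_transform :: "real measure \<Rightarrow> complex \<Rightarrow> complex" where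
  "cauchy_transform \<nu> z = (\<integral>x. 1 / (z - complex_of_real x) \<partial>\<nu>)"

(* The Cauchy transform of a compactly supported distribution maps a neighbourhood of
   infinity bijectively onto a punctured neighbourhood of 0. K is the inverse of this
   bijection; only its germ at 0 is determined, and only that germ is used below. *)
definition K_transform :: "real measure \<Rightarrow> complex \<Rightarrow> complex" where
  "K_transform \<nu> = (SOME K.
     (\<forall>\<^sub>F w in at_infinity. K (cauchy_transform \<nu> w) = w) \<and>
     (\<forall>\<^sub>F z in at 0. cauchy_transform \<nu> (K z) = z))"

definition R_transform :: "real measure \<Rightarrow> complex \<Rightarrow> complex" where
  "R_transform \<nu> z = K_transform \<nu> z - 1 / z"

(* Graph of the free additive convolution: rho is the free additive convolution of mu and nu.
   A compactly supported distribution is determined by the germ of its R-transform at 0, so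
   there is at most one such rho. *)
definition is_free_conv :: "real measure \<Rightarrow> real measure \<Rightarrow> real measure \<Rightarrow> bool" where
  "is_free_conv \<mu> \<nu> \<rho> \<longleftrightarrow>
     cs_distribution \<mu> \<and> cs_distribution \<nu> \<and> cs_distribution \<rho> \<and>
     (\<forall>\<^sub>F z in at 0. R_transform \<rho> z = R_transform \<mu> z + R_transform \<nu> z)"

inductive is_free_power :: "real measure \<Rightarrow> nat \<Rightarrow> real measure \<Rightarrow> bool" for \<nu> where
  one: "cs_distribution \<nu> \<Longrightarrow> is_free_power \<nu> 1 \<nu>"
| step: "is_free_power \<nu> n \<mu> \<Longrightarrow> is_free_conv \<mu> \<nu> \<rho> \<Longrightarrow> is_free_power \<nu> (Suc n) \<rho>"

definition free_infinitely_divisible :: "real measure \<Rightarrow> bool" where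
  "free_infinitely_divisible \<mu> \<longleftrightarrow> (\<forall>n\<ge>1. \<exists>\<nu>. is_free_power \<nu> n \<mu>)"

end

theory Submission
  imports Defs "HOL-Complex_Analysis.Complex_Analysis"
begin

text \<open>
  Write \<open>V(m) = 1 + a m + b m\<^sup>2 + \<dots>\<close>. That \<open>Q\<^sub>m\<close> has total mass one says
  \<open>G(m + V(m)/m) = m/V(m)\<close>, that is \<open>R(m/V(m)) = m\<close>, so the free cumulants of the
  generating measure \<open>\<mu>\<close> satisfy \<open>\<kappa>\<^sub>2 = 1\<close>, \<open>\<kappa>\<^sub>3 = a\<close> and \<open>\<kappa>\<^sub>4 = a\<^sup>2 + b\<close>.
  If \<open>\<mu>\<close> is the \<open>n\<close>-fold free power of \<open>\<nu>\<close>, then \<open>\<nu>\<close> has free cumulants \<open>\<kappa>\<^sub>k / n\<close>, hence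
  moments \<open>m\<^sub>2 = 1/n\<close>, \<open>m\<^sub>3 = a/n\<close> and \<open>m\<^sub>4 = (a\<^sup>2 + b)/n + 2/n\<^sup>2\<close>. Positivity of
  \<open>\<integral>x\<^sup>2(x - a)\<^sup>2 \<partial>\<nu>\<close> gives \<open>b + 2/n \<ge> 0\<close> for every \<open>n\<close>, so \<open>b \<ge> 0\<close>.
\<close>

section \<open>Moments of compactly supported distributions and the Cauchy transform near
  infinity\<close>

lemma compactly_supported_bounded:
  assumes "compactly_supported \<nu>"
  obtains C where "C > 0" "AE x in \<nu>. \<bar>x\<bar> \<le> C"
proof -
  obtain K where K: "compact K" "AE x in \<nu>. x \<in> K"
    using assms unfolding compactly_supported_def by blast
  then obtain C where C: "C > 0" "\<And>x. x \<in> K \<Longrightarrow> \<bar>x\<bar> \<le> C"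
    using bounded_pos[of K] compact_imp_bounded[of K] by auto
  have "AE x in \<nu>. \<bar>x\<bar> \<le> C" using K(2) by eventually_elim (rule C(2))
  with C(1) show ?thesis by (rule that)
qed

lemma cs_distribution_integrable_power:
  assumes "cs_distribution \<nu>"
  shows "integrable \<nu> (\<lambda>x. x ^ k)"
proof -
  interpret real_distribution \<nu> using assms by (simp add: cs_distribution_def)
  obtain C where C: "C > 0" "AE x in \<nu>. \<bar>x\<bar> \<le> C"
    using assms compactly_supported_bounded unfolding cs_distribution_def by blast
  show ?thesis
  proof (rule integrable_const_bound[where B = "C ^ k"])
    show "AE x in \<nu>. norm (x ^ k) \<le> C ^ k"
      using C(2) by eventually_elim (auto simp: power_abs intro: power_mono)
  qed simp
qed

text \<open>The ordinary generating series of the moments, with coefficients read in the complex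
  numbers so that it can expand complex functions.\<close>

definition moment_fps :: "real measure \<Rightarrow> complex fps" where
  "moment_fps \<nu> = Abs_fps (\<lambda>n. of_real (\<integral>x. x ^ n \<partial>\<nu>))"

lemma moment_fps_nth [simp]: "fps_nth (moment_fps \<nu>) n = of_real (\<integral>x. x ^ n \<partial>\<nu>)"
  by (simp add: moment_fps_def)

lemma cs_distribution_moment_0: "cs_distribution \<nu> \<Longrightarrow> fps_nth (moment_fps \<nu>) 0 = 1"
  using prob_space.prob_space[of \<nu>] by (simp add: cs_distribution_def real_distribution_def)

text \<open>
  The transform \<open>u \<mapsto> G(1/u)\<close>, written so that its value at \<open>u = 0\<close> is the
  limit \<open>0\<close>; with the convention \<open>1/0 = 0\<close> the expression \<open>G(1/0)\<close> would be \<open>G(0)\<close>.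
\<close>

definition cauchy_inv :: "real measure \<Rightarrow> complex \<Rightarrow> complex" where
  "cauchy_inv \<nu> u = u * (\<integral>x. 1 / (1 - u * complex_of_real x) \<partial>\<nu>)"

lemma cauchy_inv_0 [simp]: "cauchy_inv \<nu> 0 = 0"
  by (simp add: cauchy_inv_def)

lemma cauchy_transform_inverse:
  assumes "u \<noteq> 0"
  shows "cauchy_transform \<nu> (inverse u) = cauchy_inv \<nu> u"
proof -
  \<comment> \<open>At the pole \<open>u * x = 1\<close> both sides are 0 by the convention for
    division by zero.\<close>
  have "1 / (inverse u - complex_of_real x) = u * (1 / (1 - u * complex_of_real x))" for x
    using assms by (cases "u * complex_of_real x = 1") (auto simp: field_simps)
  then have "cauchy_transform \<nu> (inverse u) = (\<integral>x. u * (1 / (1 - u * complex_of_real x)) \<partial>\<nu>)"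
    unfolding cauchy_transform_def by presburger
  then show ?thesis unfolding cauchy_inv_def integral_mult_right_zero .
qed

text \<open>If the support lies in [-C, C] and |u| C < 1, the integrand is a geometric series
  dominated by (|u| C)^n, so it may be integrated term by term, which produces the moments.\<close>

lemma cauchy_inv_has_fps_expansion:
  assumes "cs_distribution \<nu>"
  shows "cauchy_inv \<nu> has_fps_expansion fps_X * moment_fps \<nu>"
proof -
  interpret real_distribution \<nu> using assms by (simp add: cs_distribution_def)
  obtain C where C: "C > 0" "AE x in \<nu>. \<bar>x\<bar> \<le> C"
    using assms compactly_supported_bounded unfolding cs_distribution_def by blast
  have sums: "(\<lambda>n. fps_nth (moment_fps \<nu>) n * u ^ n) sums
      (\<integral>x. 1 / (1 - u * complex_of_real x) \<partial>\<nu>)" if u: "norm u * C < 1" for u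
  proof -
    have int: "integrable \<nu> (\<lambda>x. (u * complex_of_real x) ^ n)" for n
    proof -
      have "integrable \<nu> (\<lambda>x. u ^ n * complex_of_real (x ^ n))"
        using cs_distribution_integrable_power[OF assms] by (intro integrable_mult_right integrable_of_real)
      then show ?thesis by (simp add: power_mult_distrib)
    qed
    have small: "AE x in \<nu>. norm (u * complex_of_real x) \<le> norm u * C"
      using C(2) by eventually_elim (auto simp: norm_mult intro: mult_left_mono)
    have "(\<lambda>n. \<integral>x. (u * complex_of_real x) ^ n \<partial>\<nu>) sums
        (\<integral>x. (\<Sum>n. (u * complex_of_real x) ^ n) \<partial>\<nu>)"
    proof (rule sums_integral[OF int])
      show "AE x in \<nu>. summable (\<lambda>n. norm ((u * complex_of_real x) ^ n))"
        using small by eventually_elim (use u in \<open>auto simp: norm_power\<close>)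
      show "summable (\<lambda>n. \<integral>x. norm ((u * complex_of_real x) ^ n) \<partial>\<nu>)"
      proof (rule summable_comparison_test')
        show "summable (\<lambda>n. (norm u * C) ^ n)" using u C(1) by (intro summable_geometric) auto
        fix n
        have "(\<integral>x. norm ((u * complex_of_real x) ^ n) \<partial>\<nu>) \<le> (\<integral>x. (norm u * C) ^ n \<partial>\<nu>)"
        proof (rule integral_mono_AE)
          show "integrable \<nu> (\<lambda>x. norm ((u * complex_of_real x) ^ n))"
            using int by (rule integrable_norm)
          show "AE x in \<nu>. norm ((u * complex_of_real x) ^ n) \<le> (norm u * C) ^ n"
            using small by eventually_elim (simp only: norm_power power_mono norm_ge_zero)
        qed simp
        then show "norm (\<integral>x. norm ((u * complex_of_real x) ^ n) \<partial>\<nu>) \<le> (norm u * C) ^ n"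
          using prob_space by simp
      qed
    qed
    also have "(\<lambda>n. \<integral>x. (u * complex_of_real x) ^ n \<partial>\<nu>) = (\<lambda>n. fps_nth (moment_fps \<nu>) n * u ^ n)"
    proof
      fix n
      have "(\<integral>x. (u * complex_of_real x) ^ n \<partial>\<nu>) = (\<integral>x. u ^ n * complex_of_real (x ^ n) \<partial>\<nu>)"
        by (simp add: power_mult_distrib)
      also have "\<dots> = u ^ n * of_real (\<integral>x. x ^ n \<partial>\<nu>)"
        by (simp only: integral_mult_right_zero integral_complex_of_real)
      finally show "(\<integral>x. (u * complex_of_real x) ^ n \<partial>\<nu>) = fps_nth (moment_fps \<nu>) n * u ^ n"
        by simp
    qed
    also have "(\<integral>x. (\<Sum>n. (u * complex_of_real x) ^ n) \<partial>\<nu>) = (\<integral>x. 1 / (1 - u * complex_of_real x) \<partial>\<nu>)"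
    proof (rule integral_cong_AE)
      show "AE x in \<nu>. (\<Sum>n. (u * complex_of_real x) ^ n) = 1 / (1 - u * complex_of_real x)"
        using small by eventually_elim (use u in \<open>simp add: suminf_geometric\<close>)
    qed measurable
    finally show ?thesis .
  qed
  \<comment> \<open>Convergence at the single point 1/(2C), inside the disc |u| < 1/C, already gives
    a positive radius.\<close>
  have rad: "fps_conv_radius (moment_fps \<nu>) > 0"
  proof -
    have "summable (\<lambda>n. fps_nth (moment_fps \<nu>) n * of_real (1 / (2 * C)) ^ n)"
      using C(1) by (intro sums_summable[OF sums]) (simp add: norm_divide field_simps)
    from conv_radius_geI[OF this]
    have "ereal (1 / (2 * C)) \<le> fps_conv_radius (moment_fps \<nu>)"
      using C(1) by (simp add: fps_conv_radius_def norm_divide)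
    moreover have "0 < ereal (1 / (2 * C))" using C(1) by simp
    ultimately show ?thesis by (rule less_le_trans[rotated])
  qed
  have "eventually (\<lambda>u. u \<in> ball 0 (1 / C)) (nhds (0::complex))"
    using C(1) by (intro eventually_nhds_in_open) auto
  then have "eventually (\<lambda>u. eval_fps (moment_fps \<nu>) u = (\<integral>x. 1 / (1 - u * complex_of_real x) \<partial>\<nu>)) (nhds 0)"
  proof eventually_elim
    case (elim u)
    then have "norm u * C < 1" using C(1) by (simp add: field_simps)
    from sums_unique[OF sums[OF this]] show ?case by (simp add: eval_fps_def)
  qed
  with rad have "(\<lambda>u. \<integral>x. 1 / (1 - u * complex_of_real x) \<partial>\<nu>) has_fps_expansion moment_fps \<nu>"
    by (simp add: has_fps_expansion_def)
  then have "(\<lambda>u. u * (\<integral>x. 1 / (1 - u * complex_of_real x) \<partial>\<nu>)) has_fps_expansion fps_X * moment_fps \<nu>"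
    by (intro fps_expansion_intros)
  then show ?thesis by (simp add: cauchy_inv_def[abs_def])
qed

section \<open>Local inversion of the Cauchy transform and the expansion of the R-transform\<close>

text \<open>The holomorphic inverse function theorem at 0, with the chain rule supplying the linear
  coefficient of the inverse. That coefficient later fixes the principal part of
  \<open>inverse (h z)\<close>.\<close>

lemma has_fps_expansion_local_inverse:
  fixes g :: "complex \<Rightarrow> complex"
  assumes g: "g has_fps_expansion M" and M: "fps_nth M 0 = 0" "fps_nth M 1 \<noteq> 0"
  obtains h H where "h has_fps_expansion H" "fps_nth H 0 = 0" "fps_nth M 1 * fps_nth H 1 = 1"
    "eventually (\<lambda>u. h (g u) = u) (nhds 0)" "eventually (\<lambda>z. g (h z) = z) (nhds 0)"
proof -
  obtain S where S: "open S" "0 \<in> S" "g holomorphic_on S"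
    using has_fps_expansion_imp_analytic_0[OF g] by (auto simp: analytic_at)
  have g0: "g 0 = 0" using fps_nth_fps_expansion[OF g, of 0] M by simp
  have g1: "deriv g 0 = fps_nth M 1" using fps_nth_fps_expansion[OF g, of 1] by simp
  obtain r where r: "r > 0" "ball 0 r \<subseteq> S" "open (g ` ball 0 r)" "inj_on g (ball 0 r)"
    using has_complex_derivative_locally_invertible[OF S(3,2,1)] g1 M(2) by auto
  obtain h where h: "h holomorphic_on g ` ball 0 r"
      "\<And>z. z \<in> ball 0 r \<Longrightarrow> deriv g z * deriv h (g z) = 1"
      "\<And>z. z \<in> ball 0 r \<Longrightarrow> h (g z) = z"
    using holomorphic_has_inverse[of g "ball 0 r"] r S(3) holomorphic_on_subset open_ball by metis
  have in0: "0 \<in> g ` ball 0 r" using g0 r(1) by (metis centre_in_ball imageI)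
  have "h analytic_on {0}" using h(1) r(3) in0 by (auto simp: analytic_at)
  then have H: "h has_fps_expansion fps_expansion h 0" by (rule analytic_at_imp_has_fps_expansion_0)
  show ?thesis
  proof (rule that[OF H])
    show "fps_nth (fps_expansion h 0) 0 = 0"
      using h(3)[of 0] g0 r(1) by (simp add: fps_expansion_def)
    show "fps_nth M 1 * fps_nth (fps_expansion h 0) 1 = 1"
      using h(2)[of 0] g0 g1 r(1) by (simp add: fps_expansion_def)
    show "eventually (\<lambda>u. h (g u) = u) (nhds 0)"
      using eventually_nhds_in_open[of "ball 0 r" "0::complex"] r(1) h(3) by (auto elim: eventually_mono)
    show "eventually (\<lambda>z. g (h z) = z) (nhds 0)"
      using eventually_nhds_in_open[OF r(3) in0] h(3) by (auto elim!: eventually_mono)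
  qed
qed

lemma filterlim_inverse_at_infinity_at_0:
  "filterlim inverse (at (0::complex)) at_infinity"
  by (simp add: filterlim_def at_to_infinity)

text \<open>\<open>K_transform\<close> is a Hilbert choice, so its defining properties become
  available only once a witness exists. The witness is 1/h, where h is the local inverse at 0 of u
  |-> G(1/u).\<close>

lemma K_transform_inverse:
  assumes "cs_distribution \<nu>"
  shows "\<forall>\<^sub>F w in at_infinity. K_transform \<nu> (cauchy_transform \<nu> w) = w"
proof -
  let ?g = "cauchy_inv \<nu>" and ?G = "cauchy_transform \<nu>"
  obtain h where h: "eventually (\<lambda>u. h (?g u) = u) (nhds 0)" "eventually (\<lambda>z. ?g (h z) = z) (nhds 0)"
    by (rule has_fps_expansion_local_inverse[OF cauchy_inv_has_fps_expansion[OF assms]])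
       (use cs_distribution_moment_0[OF assms] in auto)
  have "\<forall>\<^sub>F u in at 0. inverse (h (?G (inverse u))) = inverse u"
    using h(1)[THEN eventually_nhds_conv_at[THEN iffD1, THEN conjunct1]]
      eventually_neq_at_within[of 0]
    by eventually_elim (simp add: cauchy_transform_inverse)
  from eventually_compose_filterlim[OF this filterlim_inverse_at_infinity_at_0]
  have 1: "\<forall>\<^sub>F w in at_infinity. inverse (h (?G w)) = w" by simp
  have 2: "\<forall>\<^sub>F z in at 0. ?G (inverse (h z)) = z"
    using h(2)[THEN eventually_nhds_conv_at[THEN iffD1, THEN conjunct1]]
      eventually_neq_at_within[of 0]
  proof eventually_elim
    case (elim z)
    \<comment> \<open>Otherwise z = \<open>cauchy_inv \<nu> 0\<close> = 0.\<close>
    then have "h z \<noteq> 0" by auto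
    with elim show ?case by (simp add: cauchy_transform_inverse)
  qed
  from 1 2 have "(\<lambda>K. (\<forall>\<^sub>F w in at_infinity. K (?G w) = w) \<and> (\<forall>\<^sub>F z in at 0. ?G (K z) = z)) (\<lambda>z. inverse (h z))"
    by blast
  from someI[where P = "\<lambda>K. (\<forall>\<^sub>F w in at_infinity. K (?G w) = w) \<and> (\<forall>\<^sub>F z in at 0. ?G (K z) = z)", OF this]
  show ?thesis unfolding K_transform_def by blast
qed

text \<open>The pole of K at 0 is exactly 1/z, so R has a power series, whose coefficients are the
  free cumulants. The functional equation is the free moment-cumulant relation: it is K(G(1/u)) =
  1/u with G(1/u) = u M(u), cleared of denominators.\<close>

lemma R_transform_has_laurent_expansion:
  assumes "cs_distribution \<nu>"
  obtains R where "R_transform \<nu> has_laurent_expansion fps_to_fls R"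
    "moment_fps \<nu> = 1 + fps_X * ((R oo (fps_X * moment_fps \<nu>)) * moment_fps \<nu>)"
proof -
  let ?g = "cauchy_inv \<nu>" and ?G = "cauchy_transform \<nu>" and ?M = "fps_X * moment_fps \<nu>"
  have M1: "fps_nth ?M 1 = 1" using cs_distribution_moment_0[OF assms] by simp
  then have M0: "?M \<noteq> 0" by (metis fps_zero_nth zero_neq_one)
  note g = cauchy_inv_has_fps_expansion[OF assms]
  obtain h H where h: "h has_fps_expansion H" "fps_nth H 0 = 0" "fps_nth H 1 = 1"
      "eventually (\<lambda>u. h (?g u) = u) (nhds 0)" "eventually (\<lambda>z. ?g (h z) = z) (nhds 0)"
    by (rule has_fps_expansion_local_inverse[OF g]) (use M1 in auto)
  have h0: "h 0 = 0" using has_fps_expansion_imp_0_eq_fps_nth_0[OF h(1)] h(2) by simp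
  have "h \<midarrow>0\<rightarrow> 0"
    using has_fps_expansion_imp_continuous[OF h(1), of UNIV] h0 by (simp add: continuous_at)
  moreover have "\<forall>\<^sub>F z in at 0. h z \<noteq> 0"
    using h(5)[THEN eventually_nhds_conv_at[THEN iffD1, THEN conjunct1]] eventually_neq_at_within[of 0]
    by eventually_elim auto
  \<comment> \<open>The punctured limit allows u = h(z) to be substituted into statements that hold
    only for small u different from 0.\<close>
  ultimately have lim_h: "filterlim h (at 0) (at 0)" by (simp add: filterlim_at)
  have "\<forall>\<^sub>F u in at 0. K_transform \<nu> (?G (inverse u)) = inverse u"
    using K_transform_inverse[OF assms] filterlim_inverse_at_infinity
    by (rule eventually_compose_filterlim)
  then have K: "\<forall>\<^sub>F u in at 0. K_transform \<nu> (?g u) = inverse u"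
    using eventually_neq_at_within[of 0] by eventually_elim (simp add: cauchy_transform_inverse)
  have R: "\<forall>\<^sub>F z in at 0. inverse (h z) - inverse z = R_transform \<nu> z"
    using eventually_compose_filterlim[OF K lim_h]
      h(5)[THEN eventually_nhds_conv_at[THEN iffD1, THEN conjunct1]]
    by eventually_elim (simp add: R_transform_def inverse_eq_divide)
  \<comment> \<open>Factoring H = X H1 with H1(0) = 1 isolates the pole: 1/H1 = 1 + X P, hence
    1/h(z) - 1/z has the series P.\<close>
  define H1 where "H1 = fps_shift 1 H"
  have H: "H = fps_X * H1"
    using h(2) by (intro fps_ext) (auto simp: H1_def)
  have H1: "fps_nth H1 0 = 1" using h(3) by (simp add: H1_def)
  define P where "P = fps_shift 1 (inverse H1)"
  have P: "inverse H1 = 1 + fps_X * P"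
    using H1 by (intro fps_ext) (auto simp: P_def)
  have "(\<lambda>z. inverse (h z) - inverse z) has_laurent_expansion inverse (fps_to_fls H) - inverse fls_X"
    by (intro laurent_expansion_intros has_laurent_expansion_fps h(1))
  also have "inverse (fps_to_fls H) = inverse fls_X * fps_to_fls (inverse H1)"
    using H1 by (simp add: H fls_times_fps_to_fls fls_inverse_fps_to_fls)
  also have "\<dots> - inverse fls_X = fps_to_fls P"
    by (simp add: P fls_times_fps_to_fls algebra_simps)
  also have "(\<lambda>z. inverse (h z) - inverse z) has_laurent_expansion fps_to_fls P \<longleftrightarrow>
      R_transform \<nu> has_laurent_expansion fps_to_fls P"
    using R by (rule has_laurent_expansion_cong) simp
  finally have RP: "R_transform \<nu> has_laurent_expansion fps_to_fls P" .
  have "(R_transform \<nu> \<circ> ?g) has_laurent_expansion fls_compose_fps (fps_to_fls P) ?M"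
    using RP has_laurent_expansion_fps[OF g] by (rule has_laurent_expansion_compose) (use M0 in auto)
  then have Rg: "(\<lambda>u. R_transform \<nu> (?g u)) has_laurent_expansion fps_to_fls (P oo ?M)"
    using M0 by (simp add: o_def)
  \<comment> \<open>Multiplying R(g(u)) = 1/u - 1/g(u) by u g(u) gives g(u) = u + u R(g(u)) g(u), an
    identity that can be compared with the series of g.\<close>
  have "(\<lambda>u. u + u * (R_transform \<nu> (?g u) * ?g u)) has_laurent_expansion
      fls_X + fls_X * (fps_to_fls (P oo ?M) * fps_to_fls ?M)"
    by (intro laurent_expansion_intros Rg has_laurent_expansion_fps g)
  also have "(\<lambda>u. u + u * (R_transform \<nu> (?g u) * ?g u)) has_laurent_expansion
      fls_X + fls_X * (fps_to_fls (P oo ?M) * fps_to_fls ?M) \<longleftrightarrow>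
      ?g has_laurent_expansion fls_X + fls_X * (fps_to_fls (P oo ?M) * fps_to_fls ?M)"
  proof (rule has_laurent_expansion_cong)
    show "\<forall>\<^sub>F u in at 0. u + u * (R_transform \<nu> (?g u) * ?g u) = ?g u"
      using K h(4)[THEN eventually_nhds_conv_at[THEN iffD1, THEN conjunct1]]
        eventually_neq_at_within[of 0]
    proof eventually_elim
      case (elim u)
      then have "?g u \<noteq> 0" using h0 by auto
      with elim show ?case by (simp add: R_transform_def field_simps)
    qed
  qed simp
  finally have "fps_to_fls (fps_X * moment_fps \<nu>) = fps_to_fls (fps_X * (1 + (P oo ?M) * ?M))"
    using has_laurent_expansion_unique has_laurent_expansion_fps[OF g]
    by (fastforce simp: fls_times_fps_to_fls ring_distribs)
  then have "moment_fps \<nu> = 1 + (P oo ?M) * ?M"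
    by (metis fps_to_fls_eq_iff fps_X_neq_zero mult_cancel_left)
  then have "moment_fps \<nu> = 1 + fps_X * ((P oo ?M) * moment_fps \<nu>)"
    by (simp add: mult_ac)
  with RP show ?thesis by (rule that)
qed

section \<open>Free powers and free cumulants of low order\<close>

lemma free_power_cs_distribution:
  assumes "is_free_power \<nu> n \<mu>"
  shows "cs_distribution \<nu>" "cs_distribution \<mu>"
  using assms by (induction) (auto simp: is_free_conv_def)

lemma free_power_R_transform:
  assumes "is_free_power \<nu> n \<mu>"
  shows "\<forall>\<^sub>F z in at 0. R_transform \<mu> z = of_nat n * R_transform \<nu> z"
  using assms
proof induction
  case (step n \<mu> \<rho>)
  then have "\<forall>\<^sub>F z in at 0. R_transform \<rho> z = R_transform \<mu> z + R_transform \<nu> z"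
    by (simp add: is_free_conv_def)
  with step.IH show ?case by eventually_elim (simp add: algebra_simps)
qed simp

text \<open>The moment-cumulant relation is solved degree by degree. Coefficient k of R is the free
  cumulant of order k + 1. The factor 2 counts the noncrossing pairings of four points.\<close>

lemma low_order_cumulants:
  fixes A R :: "'a::comm_ring_1 fps"
  assumes "A = 1 + fps_X * ((R oo (fps_X * A)) * A)" and "fps_nth A 1 = 0"
  shows "fps_nth R 0 = 0" "fps_nth R 1 = fps_nth A 2" "fps_nth R 2 = fps_nth A 3"
    "fps_nth R 3 = fps_nth A 4 - 2 * (fps_nth A 2)\<^sup>2"
proof -
  define C where "C = (R oo (fps_X * A))"
  have A: "fps_nth A 0 = 1" "\<And>n. fps_nth A (Suc n) = fps_nth (C * A) n"
    by (subst assms(1), simp add: C_def)+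
  note nth = fps_mult_nth numeral_eq_Suc fps_compose_nth power_Suc
  have C0: "fps_nth C 0 = fps_nth R 0" by (simp add: C_def)
  show R0: "fps_nth R 0 = 0" using A(2)[of 0] assms(2) A(1) C0 by simp
  have C1: "fps_nth C 1 = fps_nth R 1" using A(1) by (simp add: C_def nth)
  show R1: "fps_nth R 1 = fps_nth A 2"
    using A(2)[of 1] C0 C1 A(1) assms(2) R0 by (simp add: nth)
  have C2: "fps_nth C 2 = fps_nth R 2" using A(1) assms(2) by (simp add: C_def nth)
  show R2: "fps_nth R 2 = fps_nth A 3"
    using A(2)[of 2] C0 C1 C2 A(1) assms(2) R0 by (simp add: nth)
  \<comment> \<open>The quadratic term of R contributes twice the first moment here, which is
    0.\<close>
  have C3: "fps_nth C 3 = fps_nth R 1 * fps_nth A 2 + fps_nth R 3" using A(1) assms(2) by (simp add: C_def nth)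
  show "fps_nth R 3 = fps_nth A 4 - 2 * (fps_nth A 2)\<^sup>2"
    using A(2)[of 3] C0 C1 C2 C3 A(1) assms(2) R0 R1 by (simp add: nth algebra_simps)
qed

text \<open>With F the series of V, the hypothesis is R(m / V(m)) = m. Comparing coefficients up to
  degree 3 expresses the free cumulants through the Taylor coefficients of V.\<close>

lemma compose_right_inverse_coeffs:
  fixes F R :: "complex fps"
  assumes "R oo (fps_X * inverse F) = fps_X" and F0: "fps_nth F 0 = 1"
  shows "fps_nth R 1 = 1" "fps_nth R 2 = fps_nth F 1" "fps_nth R 3 = (fps_nth F 1)\<^sup>2 + fps_nth F 2"
proof -
  define I where "I = inverse F"
  have IF: "I * F = 1" using F0 by (simp add: I_def inverse_mult_eq_1)
  note nth = fps_mult_nth numeral_eq_Suc fps_compose_nth power_Suc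
  have I0: "fps_nth I 0 = 1" using F0 by (simp add: I_def)
  have I1: "fps_nth I 1 = - fps_nth F 1"
    using arg_cong[OF IF, of "\<lambda>f. fps_nth f 1"] I0 F0 by (simp add: nth eq_neg_iff_add_eq_0 add_ac)
  have I2: "fps_nth I 2 = (fps_nth F 1)\<^sup>2 - fps_nth F 2"
    using arg_cong[OF IF, of "\<lambda>f. fps_nth f 2"] I0 I1 F0 by (simp add: nth algebra_simps)
  have eq: "fps_nth (R oo (fps_X * I)) n = fps_nth fps_X n" for n using assms by (simp add: I_def)
  show R1: "fps_nth R 1 = 1" using eq[of 1] I0 by (simp add: nth)
  show R2: "fps_nth R 2 = fps_nth F 1" using eq[of 2] I0 I1 R1 by (simp add: nth)
  have "fps_nth I 2 + fps_nth R 3 = 2 * (fps_nth F 1 * fps_nth F 1)"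
    using eq[of 3] I0 I1 R1 R2 by (simp add: nth algebra_simps)
  with I2 show "fps_nth R 3 = (fps_nth F 1)\<^sup>2 + fps_nth F 2"
    by algebra
qed

section \<open>Free cumulants of the generating measure from the variance function\<close>

text \<open>The density of Q_m is V(m)/m times the Cauchy kernel at m + V(m)/m, so total mass one
  evaluates G at that point.\<close>

lemma fef_cauchy_transform:
  fixes m :: real
  assumes cs: "cs_distribution \<nu>" and mean: "mean \<nu> = 0" and m: "m \<noteq> 0" and V: "V m > 0"
    and pos: "AE x in \<nu>. 0 < V m + m * (m - x)" and prob: "prob_space (fef_member \<nu> V m)"
  shows "cauchy_transform \<nu> (of_real (m + V m / m)) = of_real (m / V m)"
proof -
  interpret real_distribution \<nu> using cs by (simp add: cs_distribution_def)
  let ?f = "\<lambda>x. V m / (V m + m * (m - x))"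
  have "(\<integral>\<^sup>+x. ennreal (?f x) \<partial>\<nu>) = 1"
    using prob_space.emeasure_space_1[OF prob] mean
    by (simp add: fef_member_def emeasure_density)
  \<comment> \<open>By \<open>pos\<close> the density is nonnegative almost everywhere, so
    \<open>ennreal\<close> truncates nothing and the two integrals agree.\<close>
  then have int: "(\<integral>x. ?f x \<partial>\<nu>) = 1"
  proof (subst integral_eq_nn_integral)
    show "AE x in \<nu>. 0 \<le> ?f x" using pos by eventually_elim (use V in auto)
  qed auto
  \<comment> \<open>This includes x = m + V(m)/m, where both sides are 0 by convention.\<close>
  have "1 / (of_real (m + V m / m) - complex_of_real x) = of_real (m / V m) * complex_of_real (?f x)" for x
  proof -
    have "m + V m / m - x = (V m + m * (m - x)) / m" using m by (simp add: field_simps)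
    then have "1 / (m + V m / m - x) = m / V m * ?f x" using V by simp
    then have "complex_of_real (1 / (m + V m / m - x)) = complex_of_real (m / V m * ?f x)" by simp
    then show ?thesis by (simp only: of_real_divide of_real_diff of_real_mult of_real_1)
  qed
  then have "cauchy_transform \<nu> (of_real (m + V m / m)) =
      (\<integral>x. of_real (m / V m) * complex_of_real (?f x) \<partial>\<nu>)"
    unfolding cauchy_transform_def by presburger
  also have "\<dots> = of_real (m / V m)"
    unfolding integral_mult_right_zero integral_complex_of_real int by simp
  finally show ?thesis .
qed

text \<open>Since V(0) = 1, the point m + V(m)/m tends to infinity as m tends to 0, where K inverts
  G. Thus K(m/V(m)) = m + V(m)/m, and subtracting V(m)/m leaves m.\<close>

lemma fef_R_transform:
  assumes fef: "generates_fef \<nu> V" and mean: "mean \<nu> = 0" and cont: "isCont V 0" and V0: "V 0 = 1"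
  shows "\<forall>\<^sub>F m in at (0::real). R_transform \<nu> (of_real (m / V m)) = of_real m"
proof -
  obtain A B where AB: "0 \<in> einterval A B" and mem: "\<And>m. m \<in> einterval A B \<Longrightarrow> 0 < V m \<and>
      (AE x in \<nu>. 0 < V m + m * (m - x)) \<and> prob_space (fef_member \<nu> V m)"
    using fef mean unfolding generates_fef_def by auto
  have cs: "cs_distribution \<nu>" using fef by (simp add: generates_fef_def)
  have "filterlim (\<lambda>m. (m\<^sup>2 + V m) / m) at_infinity (at 0)"
  proof (rule filterlim_divide_at_infinity)
    show "((\<lambda>m. m\<^sup>2 + V m) \<longlongrightarrow> 0\<^sup>2 + V 0) (at 0)"
      using cont by (intro tendsto_intros) (simp add: isCont_def)
    show "filterlim (\<lambda>m. m) (at 0) (at (0::real))" by (rule filterlim_ident)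
  qed (simp add: V0)
  then have lim: "filterlim (\<lambda>m. complex_of_real ((m\<^sup>2 + V m) / m)) at_infinity (at 0)"
    by (intro filterlim_norm_at_top_imp_at_infinity)
       (simp only: norm_of_real flip: real_norm_def, rule filterlim_at_infinity_imp_norm_at_top)
  have "\<forall>\<^sub>F m in at 0. m \<in> einterval A B"
    using AB by (intro eventually_at_in_open') (auto simp: open_einterval)
  with eventually_compose_filterlim[OF K_transform_inverse[OF cs] lim] eventually_neq_at_within[of 0]
  show ?thesis
  proof eventually_elim
    case (elim m)
    have eq: "(m\<^sup>2 + V m) / m = m + V m / m" using elim by (simp add: field_simps power2_eq_square)
    have "cauchy_transform \<nu> (of_real (m + V m / m)) = of_real (m / V m)"
      using mem[OF elim(3)] elim(2) by (intro fef_cauchy_transform[OF cs mean]) auto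
    with elim(1) have "K_transform \<nu> (of_real (m / V m)) = of_real (m + V m / m)"
      unfolding eq by simp
    then show ?case by (simp add: R_transform_def)
  qed
qed

text \<open>
  Power series composition is available over the complex numbers only, so the real germ is
  continued to the complex plane.
\<close>

lemma has_fps_expansion_complexify:
  fixes f :: "real \<Rightarrow> real"
  assumes "f has_fps_expansion F"
  obtains g where "g has_fps_expansion Abs_fps (\<lambda>n. complex_of_real (fps_nth F n))"
    "\<forall>\<^sub>F t in nhds 0. g (of_real t) = of_real (f t)"
proof -
  let ?F = "Abs_fps (\<lambda>n. complex_of_real (fps_nth F n))"
  have rad: "fps_conv_radius ?F = fps_conv_radius F"
    unfolding fps_conv_radius_def conv_radius_def by simp
  have F: "fps_conv_radius F > 0" "\<forall>\<^sub>F t in nhds 0. eval_fps F t = f t"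
    using assms by (auto simp: has_fps_expansion_def)
  have "\<forall>\<^sub>F t in nhds 0. t \<in> eball 0 (fps_conv_radius F)"
    using F(1) by (intro eventually_nhds_in_open) (auto simp: zero_ereal_def)
  with F(2) have "\<forall>\<^sub>F t in nhds 0. eval_fps ?F (of_real t) = of_real (f t)"
  proof eventually_elim
    case (elim t)
    then have "summable (\<lambda>n. fps_nth F n * t ^ n)"
      by (intro summable_fps) auto
    from suminf_of_real[OF this, where 'a = complex] elim(1) show ?case
      by (simp add: eval_fps_def)
  qed
  moreover have "eval_fps ?F has_fps_expansion ?F"
    using F(1) rad by (intro eval_fps_has_fps_expansion) simp
  ultimately show ?thesis using that by blast
qed

text \<open>The equation R(m/V(m)) = m is known for small real m only. The identity theorem for the
  Laurent germ of the difference turns it into an identity of complex power series.\<close>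

lemma fef_free_cumulants:
  assumes fef: "generates_fef \<nu> V" and mean: "mean \<nu> = 0" and V: "V has_fps_expansion F"
    and V0: "V 0 = 1" and R: "R_transform \<nu> has_laurent_expansion fps_to_fls R"
  shows "fps_nth R 1 = 1"
    and "fps_nth R 2 = of_real (fps_nth F 1)"
    and "fps_nth R 3 = of_real ((fps_nth F 1)\<^sup>2 + fps_nth F 2)"
proof -
  let ?F = "Abs_fps (\<lambda>n. complex_of_real (fps_nth F n))"
  obtain g where g: "g has_fps_expansion ?F" "\<forall>\<^sub>F t in nhds 0. g (of_real t) = of_real (V t)"
    using has_fps_expansion_complexify[OF V] .
  have g0: "g 0 = 1" using eventually_nhds_x_imp_x[OF g(2)] V0 by simp
  then have F0: "fps_nth ?F 0 = 1" using has_fps_expansion_imp_0_eq_fps_nth_0[OF g(1)] by simp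
  let ?P = "fps_X * inverse ?F"
  have P: "(\<lambda>z. z * inverse (g z)) has_fps_expansion ?P"
    using g(1) F0 by (intro fps_expansion_intros) auto
  have P0: "?P \<noteq> 0" using F0 by (metis fps_X_neq_zero fps_inverse_eq_0_iff mult_eq_0_iff zero_neq_one)
  have "(R_transform \<nu> \<circ> (\<lambda>z. z * inverse (g z))) has_laurent_expansion
      fls_compose_fps (fps_to_fls R) ?P"
    using R has_laurent_expansion_fps[OF P] by (rule has_laurent_expansion_compose) (use P0 in auto)
  then have "(\<lambda>z. R_transform \<nu> (z * inverse (g z))) has_laurent_expansion fps_to_fls (R oo ?P)"
    using P0 by (simp add: o_def)
  then have "(\<lambda>z. R_transform \<nu> (z * inverse (g z)) - z) has_laurent_expansion
      fps_to_fls (R oo ?P) - fls_X"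
    by (intro laurent_expansion_intros)
  then have D: "(\<lambda>z. R_transform \<nu> (z * inverse (g z)) - z) has_laurent_expansion
      fps_to_fls ((R oo ?P) - fps_X)" by simp
  \<comment> \<open>Zeros accumulating at 0 suffice to annihilate the expansion; small nonzero reals
    supply them.\<close>
  have "\<exists>\<^sub>F z in at 0. R_transform \<nu> (z * inverse (g z)) - z = 0"
  proof (rule ccontr)
    assume "\<not> ?thesis"
    then have "\<forall>\<^sub>F z in at 0. R_transform \<nu> (z * inverse (g z)) - z \<noteq> 0"
      by (simp add: not_frequently)
    moreover have "filterlim complex_of_real (at 0) (at 0)"
      by (auto simp: filterlim_at eventually_at_filter intro!: tendsto_eq_intros)
    ultimately have "\<forall>\<^sub>F t in at 0. R_transform \<nu> (of_real t * inverse (g (of_real t))) - of_real t \<noteq> 0"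
      by (rule eventually_compose_filterlim)
    moreover have "isCont V 0" using has_fps_expansion_imp_continuous[OF V] .
    from fef_R_transform[OF fef mean this V0]
    have "\<forall>\<^sub>F t in at (0::real). R_transform \<nu> (of_real (t / V t)) = of_real t" .
    moreover have "\<forall>\<^sub>F t in at 0. g (of_real t) = of_real (V t)"
      using g(2) by (simp add: eventually_nhds_conv_at)
    ultimately have "\<forall>\<^sub>F t in at (0::real). False"
      by eventually_elim (simp add: divide_inverse)
    then show False by simp
  qed
  moreover have "(\<exists>\<^sub>F z in at 0. R_transform \<nu> (z * inverse (g z)) - z = 0) \<longleftrightarrow>
      fps_to_fls ((R oo ?P) - fps_X) = 0"
    by (rule has_laurent_expansion_frequently_zero_iff) (use D in simp)
  ultimately have "(R oo ?P) - fps_X = 0" using fps_to_fls_eq_0_iff by blast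
  then have "R oo ?P = fps_X" by simp
  from compose_right_inverse_coeffs[OF this F0] show
    "fps_nth R 1 = 1" "fps_nth R 2 = of_real (fps_nth F 1)" "fps_nth R 3 = of_real ((fps_nth F 1)\<^sup>2 + fps_nth F 2)"
    by simp_all
qed

section \<open>Moments, positivity and the contradiction\<close>

lemma free_cumulants_eq_moments:
  assumes "cs_distribution \<nu>" and "R_transform \<nu> has_laurent_expansion fps_to_fls R"
  shows "fps_nth R 0 = of_real (mean \<nu>)"
    and "mean \<nu> = 0 \<Longrightarrow> fps_nth R 1 = of_real (\<integral>x. x ^ 2 \<partial>\<nu>)"
    and "mean \<nu> = 0 \<Longrightarrow> fps_nth R 2 = of_real (\<integral>x. x ^ 3 \<partial>\<nu>)"
    and "mean \<nu> = 0 \<Longrightarrow> fps_nth R 3 = of_real ((\<integral>x. x ^ 4 \<partial>\<nu>) - 2 * (\<integral>x. x ^ 2 \<partial>\<nu>)\<^sup>2)"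
proof -
  obtain Q where Q: "R_transform \<nu> has_laurent_expansion fps_to_fls Q"
    "moment_fps \<nu> = 1 + fps_X * ((Q oo (fps_X * moment_fps \<nu>)) * moment_fps \<nu>)"
    using R_transform_has_laurent_expansion[OF assms(1)] .
  have "Q = R" using has_laurent_expansion_unique[OF Q(1) assms(2)] by simp
  note eq = Q(2)[unfolded this]
  have "fps_nth (moment_fps \<nu>) 1 = fps_nth R 0 * fps_nth (moment_fps \<nu>) 0"
    by (subst eq) (simp del: moment_fps_nth)
  then show "fps_nth R 0 = of_real (mean \<nu>)"
    using cs_distribution_moment_0[OF assms(1)] by (simp add: mean_def)
  assume "mean \<nu> = 0"
  then have "fps_nth (moment_fps \<nu>) 1 = 0" by (simp add: mean_def)
  from low_order_cumulants[OF eq this] show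
    "fps_nth R 1 = of_real (\<integral>x. x ^ 2 \<partial>\<nu>)" "fps_nth R 2 = of_real (\<integral>x. x ^ 3 \<partial>\<nu>)"
    "fps_nth R 3 = of_real ((\<integral>x. x ^ 4 \<partial>\<nu>) - 2 * (\<integral>x. x ^ 2 \<partial>\<nu>)\<^sup>2)"
    by simp_all
qed

text \<open>This integrates x^2 (x - t)^2; it is the quadratic form of the Hankel matrix of the
  moments of orders 2, 3, 4 at the vector (-t, 1).\<close>

lemma moment_hankel_nonneg:
  fixes t :: real
  assumes "cs_distribution \<nu>"
  shows "0 \<le> (\<integral>x. x ^ 4 \<partial>\<nu>) - 2 * t * (\<integral>x. x ^ 3 \<partial>\<nu>) + t\<^sup>2 * (\<integral>x. x ^ 2 \<partial>\<nu>)"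
proof -
  note int = cs_distribution_integrable_power[OF assms]
  have "0 \<le> (\<integral>x. (x * (x - t))\<^sup>2 \<partial>\<nu>)" by simp
  also have "(\<lambda>x. (x * (x - t))\<^sup>2) = (\<lambda>x. x ^ 4 - 2 * t * x ^ 3 + t\<^sup>2 * x ^ 2)"
    by (auto simp: power2_eq_square algebra_simps numeral_eq_Suc)
  also have "(\<integral>x. x ^ 4 - 2 * t * x ^ 3 + t\<^sup>2 * x ^ 2 \<partial>\<nu>) =
      (\<integral>x. x ^ 4 \<partial>\<nu>) - 2 * t * (\<integral>x. x ^ 3 \<partial>\<nu>) + t\<^sup>2 * (\<integral>x. x ^ 2 \<partial>\<nu>)"
    using int by (simp del: mult_minus_right)
  finally show ?thesis .
qed

lemma deriv_2_fps_expansion: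
  fixes f :: "'a::{banach,real_normed_field} \<Rightarrow> 'a"
  assumes "f has_fps_expansion F"
  shows "(deriv ^^ 2) f 0 = 2 * fps_nth F 2"
proof -
  have "deriv (deriv f) has_fps_expansion fps_deriv (fps_deriv F)"
    using assms by (intro fps_expansion_intros)
  then have "eval_fps (fps_deriv (fps_deriv F)) 0 = deriv (deriv f) 0"
    unfolding has_fps_expansion_def using eventually_nhds_x_imp_x by blast
  then show ?thesis by (simp add: eval_fps_at_0 numeral_2_eq_2)
qed

theorem corollary3p8:
  fixes V :: "real \<Rightarrow> real"
  assumes "\<exists>F. V has_fps_expansion F"
    and "V 0 = 1"
    and "(deriv ^^ 2) V 0 < 0"
  shows "\<not> (\<exists>\<nu>. cs_distribution \<nu> \<and> mean \<nu> = 0 \<and> free_infinitely_divisible \<nu> \<and>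
                generates_fef \<nu> V)"
proof
  assume "\<exists>\<nu>. cs_distribution \<nu> \<and> mean \<nu> = 0 \<and> free_infinitely_divisible \<nu> \<and> generates_fef \<nu> V"
  then obtain \<mu> where \<mu>: "cs_distribution \<mu>" "mean \<mu> = 0" "free_infinitely_divisible \<mu>"
    "generates_fef \<mu> V" by blast
  obtain F where F: "V has_fps_expansion F" using assms(1) by blast
  define a b where "a = fps_nth F 1" and "b = fps_nth F 2"
  have b: "b < 0" using deriv_2_fps_expansion[OF F] assms(3) by (simp add: b_def)
  obtain R where R: "R_transform \<mu> has_laurent_expansion fps_to_fls R"
    using R_transform_has_laurent_expansion[OF \<mu>(1)] by blast
  have R0: "fps_nth R 0 = 0" using free_cumulants_eq_moments(1)[OF \<mu>(1) R] \<mu>(2) by simp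
  have R1: "fps_nth R 1 = 1" and R2: "fps_nth R 2 = of_real a" and R3: "fps_nth R 3 = of_real (a\<^sup>2 + b)"
    using fef_free_cumulants[OF \<mu>(4,2) F assms(2) R] by (simp_all add: a_def b_def)
  \<comment> \<open>The 2 is n^2 times 2/n^2, the excess of the fourth moment of the n-th free root
    over its fourth free cumulant. It stays bounded while -b n grows.\<close>
  have "- b * n \<le> 2" if n: "n \<ge> 1" for n :: nat
  proof -
    obtain \<nu> where \<nu>: "is_free_power \<nu> n \<mu>"
      using \<mu>(3) n unfolding free_infinitely_divisible_def by blast
    have cs: "cs_distribution \<nu>" using free_power_cs_distribution[OF \<nu>] by simp
    obtain Q where Q: "R_transform \<nu> has_laurent_expansion fps_to_fls Q"
      using R_transform_has_laurent_expansion[OF cs] by blast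
    have "(\<lambda>z. of_nat n * R_transform \<nu> z) has_laurent_expansion fls_const (of_nat n) * fps_to_fls Q"
      using Q by (intro laurent_expansion_intros)
    also have "(\<lambda>z. of_nat n * R_transform \<nu> z) has_laurent_expansion fls_const (of_nat n) * fps_to_fls Q
        \<longleftrightarrow> R_transform \<mu> has_laurent_expansion fps_to_fls (fps_const (of_nat n) * Q)"
      using free_power_R_transform[OF \<nu>]
      by (intro has_laurent_expansion_cong) (auto simp: fls_times_fps_to_fls eq_commute)
    finally have "R = fps_const (of_nat n) * Q" using has_laurent_expansion_unique[OF R] fps_to_fls_eq_iff by blast
    then have Qk: "fps_nth R k = of_nat n * fps_nth Q k" for k by simp
    \<comment> \<open>As n is nonzero, the root inherits the vanishing first cumulant, so the
      centered moment formulas apply to it.\<close>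
    have mean: "mean \<nu> = 0" using free_cumulants_eq_moments(1)[OF cs Q] Qk[of 0] R0 n by simp
    have k: "1 = n * (\<integral>x. x ^ 2 \<partial>\<nu>)" "a = n * (\<integral>x. x ^ 3 \<partial>\<nu>)"
      "a\<^sup>2 + b = n * ((\<integral>x. x ^ 4 \<partial>\<nu>) - 2 * (\<integral>x. x ^ 2 \<partial>\<nu>)\<^sup>2)"
    proof -
      have "complex_of_real 1 = of_real (n * (\<integral>x. x ^ 2 \<partial>\<nu>))"
        using Qk[of 1] free_cumulants_eq_moments(2)[OF cs Q mean] R1 by simp
      then show "1 = n * (\<integral>x. x ^ 2 \<partial>\<nu>)" unfolding of_real_eq_iff .
      have "complex_of_real a = of_real (n * (\<integral>x. x ^ 3 \<partial>\<nu>))"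
        using Qk[of 2] free_cumulants_eq_moments(3)[OF cs Q mean] R2 by simp
      then show "a = n * (\<integral>x. x ^ 3 \<partial>\<nu>)" unfolding of_real_eq_iff .
      have "complex_of_real (a\<^sup>2 + b) = of_real (n * ((\<integral>x. x ^ 4 \<partial>\<nu>) - 2 * (\<integral>x. x ^ 2 \<partial>\<nu>)\<^sup>2))"
        using Qk[of 3] free_cumulants_eq_moments(4)[OF cs Q mean] R3 by simp
      then show "a\<^sup>2 + b = n * ((\<integral>x. x ^ 4 \<partial>\<nu>) - 2 * (\<integral>x. x ^ 2 \<partial>\<nu>)\<^sup>2)"
        unfolding of_real_eq_iff .
    qed
    have eq: "n * (a\<^sup>2 + b) = (n\<^sup>2 * (\<integral>x. x ^ 4 \<partial>\<nu>)) - 2 * (n * (\<integral>x. x ^ 2 \<partial>\<nu>))\<^sup>2"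
      unfolding k(3) by (simp add: power2_eq_square algebra_simps)
    \<comment> \<open>The choice t = a is the ratio of the third to the second moment of the root,
      which minimizes the quadratic form in t and does not depend on n. The factor n^2 clears
      denominators.\<close>
    have "0 \<le> n\<^sup>2 * ((\<integral>x. x ^ 4 \<partial>\<nu>) - 2 * a * (\<integral>x. x ^ 3 \<partial>\<nu>) + a\<^sup>2 * (\<integral>x. x ^ 2 \<partial>\<nu>))"
      using moment_hankel_nonneg[OF cs, of a] by simp
    also have "\<dots> = n\<^sup>2 * (\<integral>x. x ^ 4 \<partial>\<nu>) - 2 * n * a * (n * (\<integral>x. x ^ 3 \<partial>\<nu>)) +
        n * a\<^sup>2 * (n * (\<integral>x. x ^ 2 \<partial>\<nu>))"
      by (simp add: power2_eq_square algebra_simps)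
    also have "\<dots> = n * b + 2"
      using eq unfolding k(1,2)[symmetric] by (simp add: power2_eq_square algebra_simps)
    finally show ?thesis by (simp add: mult.commute)
  qed
  moreover obtain n :: nat where "n > 2 / (- b)" using reals_Archimedean2 by blast
  \<comment> \<open>Since 2/(-b) is positive, n = 0 is excluded.\<close>
  moreover from this b have "n \<ge> 1" by (cases n) (auto simp: field_simps)
  ultimately show False using b by (fastforce simp: field_simps)
qed

end
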